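(* Let $A\in\mathbb{R}^{m\times n}$ and $q\in[1,2]$. Then, for any symmetric positive definite $\Lambda\in\mathbb{R}^{m\times m}$, $$\|A\|_{S_q}^2\le\|\Lambda\|_{S_{\frac{q}{2-q}}}\,\mathrm{Tr}(AA^T\Lambda^{-1}),$$ where $S_{\frac{q}{2-q}}$ is interpreted as $S_\infty$ when $q=2$.
   Context: For $r\in[1,\infty]$, $\|Z\|_{S_r}$ is the Schatten-$r$ norm, i.e. the $\ell_r$ norm of the vector of singular values of $Z$. *)

theory Defs
  imports "HOL-Analysis.Analysis" "HOL-Computational_Algebra.Polynomial"
begin

definition charpoly :: "'a::comm_ring_1^'n^'n \<Rightarrow> 'a poly" where
  "charpoly M = det (\<chi> i j. (if i = j then [:0, 1:] else 0) - [:M $ i $ j:])"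

text \<open>
  The singular values of \<open>Z\<close> are the square roots of the eigenvalues of \<open>Z\<^sup>T Z\<close>, repeated
  according to multiplicity. For an \<open>m \<times> n\<close> matrix this gives \<open>n\<close> values; compared with the
  convention that lists only \<open>min m n\<close> of them, the additional ones are all zero and hence do
  not affect any \<open>\<ell>\<^sub>r\<close> norm.
\<close>

definition singular_values :: "real^'n^'m \<Rightarrow> real multiset" where
  "singular_values Z = image_mset sqrt (proots (charpoly (transpose Z ** Z)))"

text \<open>The definition is meant for \<open>1 \<le> r \<le> \<infinity>\<close>.\<close>

definition schatten_norm :: "ereal \<Rightarrow> real^'n^'m \<Rightarrow> real" where
  "schatten_norm r Z =
     (if r = \<infinity> then Max (set_mset (singular_values Z))
      else (\<Sum>\<sigma>\<in>#singular_values Z. \<sigma> powr real_of_ereal r) powr (1 / real_of_ereal r))"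

definition symmetric_matrix :: "real^'m^'m \<Rightarrow> bool" where
  "symmetric_matrix M \<longleftrightarrow> transpose M = M"

definition positive_definite :: "real^'m^'m \<Rightarrow> bool" where
  "positive_definite M \<longleftrightarrow> (\<forall>x. x \<noteq> 0 \<longrightarrow> x \<bullet> (M *v x) > 0)"

end

theory Submission
  imports Defs
begin

text \<open>
  Let \<open>u\<^sub>i\<close> be an orthonormal eigenbasis of \<open>A\<^sup>T A\<close> and \<open>v\<^sub>j\<close> one of \<open>\<Lambda>\<close>, with \<open>s\<^sub>i = \<parallel>A u\<^sub>i\<parallel>\<close> the singular
  values of \<open>A\<close> and \<open>\<mu>\<^sub>j\<close> the eigenvalues of \<open>\<Lambda>\<close>. With \<open>d\<^sub>i\<^sub>j = (A u\<^sub>i / s\<^sub>i \<bullet> v\<^sub>j)\<^sup>2\<close> the trace is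
  \<open>\<Sum>\<^sub>i\<^sub>j d\<^sub>i\<^sub>j s\<^sub>i\<^sup>2 / \<mu>\<^sub>j\<close>. Parseval gives \<open>\<Sum>\<^sub>j d\<^sub>i\<^sub>j = 1\<close> whenever \<open>s\<^sub>i > 0\<close>, and Bessel gives
  \<open>\<Sum>\<^sub>i d\<^sub>i\<^sub>j \<le> 1\<close>, because the \<open>A u\<^sub>i\<close> are pairwise orthogonal. Hence
  \<open>\<Sum>\<^sub>i s\<^sub>i\<^sup>q = \<Sum>\<^sub>i\<^sub>j d\<^sub>i\<^sub>j (s\<^sub>i\<^sup>2 / \<mu>\<^sub>j)\<^bsup>q/2\<^esup> \<mu>\<^sub>j\<^bsup>q/2\<^esup>\<close>, and Hoelder's inequality with weights \<open>d\<^sub>i\<^sub>j\<close> and exponents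
  \<open>2/q\<close>, \<open>2/(2 - q)\<close> yields the claim.
\<close>

section \<open>Spectral theorem for self-adjoint maps on invariant subspaces\<close>

text \<open>First-order optimality: the residual \<open>w = f v - c *\<^sub>R v\<close> lies in
  \<open>S\<close> and is orthogonal to \<open>v\<close>, so if it were nonzero, a small step along
  it would raise the Rayleigh quotient above its maximum \<open>c\<close>.\<close>

lemma selfadjoint_sphere_max_eigenvector:
  fixes f :: "'a::euclidean_space \<Rightarrow> 'a"
  assumes f: "linear f" and adj: "\<And>x y. f x \<bullet> y = x \<bullet> f y"
    and S: "subspace S" "f ` S \<subseteq> S"
    and v: "v \<in> S" "norm v = 1"
    and max: "\<And>x. \<lbrakk>x \<in> S; norm x = 1\<rbrakk> \<Longrightarrow> x \<bullet> f x \<le> v \<bullet> f v"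
  shows "f v = (v \<bullet> f v) *\<^sub>R v"
proof -
  define c where "c = v \<bullet> f v"
  define w where "w = f v - c *\<^sub>R v"
  have vv: "v \<bullet> v = 1"
    using v(2) by (simp add: dot_square_norm)
  have wS: "w \<in> S"
    unfolding w_def using S v by (auto intro: subspace_diff subspace_scale)
  have wv: "w \<bullet> v = 0" "v \<bullet> w = 0"
    by (simp_all add: w_def c_def inner_diff_left inner_diff_right vv inner_commute)
  have wfv: "w \<bullet> f v = w \<bullet> w"
    using wv by (simp add: w_def inner_diff_right algebra_simps)
  have bound: "x \<bullet> f x \<le> c * (x \<bullet> x)" if "x \<in> S" for x
  proof (cases "x = 0")
    case False
    let ?y = "x /\<^sub>R norm x"
    have "?y \<bullet> f ?y \<le> c"
      unfolding c_def using False that S(1) by (intro max) (auto intro: subspace_scale)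
    then have "(x \<bullet> f x) / (norm x)\<^sup>2 \<le> c"
      using f by (simp add: linear_cmul power2_eq_square divide_simps)
    then show ?thesis
      using False by (simp add: dot_square_norm field_simps)
  qed (use f in \<open>simp add: linear_0\<close>)
  \<comment> \<open>Perturb the maximiser \<open>v\<close> in the direction of the residual \<open>w\<close>.\<close>
  have quad: "2 * t * (w \<bullet> w) \<le> t\<^sup>2 * (c * (w \<bullet> w) - w \<bullet> f w)" for t :: real
  proof -
    have "(v + t *\<^sub>R w) \<bullet> f (v + t *\<^sub>R w) \<le> c * ((v + t *\<^sub>R w) \<bullet> (v + t *\<^sub>R w))"
      using S(1) v(1) wS by (intro bound) (auto intro: subspace_add subspace_scale)
    moreover have "v \<bullet> f w = w \<bullet> w"
      using adj[of v w] wfv by (simp add: inner_commute)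
    ultimately show ?thesis
      using f wfv wv vv
      by (simp add: linear_add linear_cmul inner_add_left inner_add_right c_def[symmetric]
          power2_eq_square algebra_simps)
  qed
  have "w \<bullet> w = 0"
  proof (rule ccontr)
    define K where "K = c * (w \<bullet> w) - w \<bullet> f w"
    assume "w \<bullet> w \<noteq> 0"
    then have pos: "w \<bullet> w > 0"
      by simp
    \<comment> \<open>Small enough that the second-order term \<open>t * \<bar>K\<bar>\<close> stays
      below \<open>w \<bullet> w\<close>, contradicting \<open>quad\<close> divided by
      \<open>t\<close>.\<close>
    define t where "t = (w \<bullet> w) / (\<bar>K\<bar> + 1)"
    have t: "t > 0" "t * \<bar>K\<bar> < w \<bullet> w"
      using pos by (auto simp: t_def field_simps)
    have "t * (2 * (w \<bullet> w)) \<le> t * (t * K)"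
      using quad[of t] by (simp add: K_def power2_eq_square algebra_simps)
    then have "2 * (w \<bullet> w) \<le> t * K"
      using t(1) by simp
    also have "\<dots> \<le> t * \<bar>K\<bar>"
      using t(1) by simp
    finally show False
      using t(2) pos by linarith
  qed
  then show ?thesis
    by (simp add: w_def c_def)
qed

text \<open>By induction on the dimension: compactness of the unit sphere of \<open>S\<close> yields
  a maximiser \<open>v\<close>, an eigenvector, and self-adjointness keeps its orthogonal complement
  in \<open>S\<close> invariant. Allowing any invariant \<open>S\<close> is what lets the induction
  pass to that complement.\<close>

theorem selfadjoint_orthonormal_eigenbasis:
  fixes f :: "'a::euclidean_space \<Rightarrow> 'a"
  assumes f: "linear f" and adj: "\<And>x y. f x \<bullet> y = x \<bullet> f y"
    and S: "subspace S" "f ` S \<subseteq> S"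
  obtains B where "B \<subseteq> S" "pairwise orthogonal B" "\<And>b. b \<in> B \<Longrightarrow> norm b = 1"
    "\<And>b. b \<in> B \<Longrightarrow> \<exists>c. f b = c *\<^sub>R b" "S \<subseteq> span B"
proof -
  have "\<exists>B \<subseteq> S. pairwise orthogonal B \<and> (\<forall>b\<in>B. norm b = 1) \<and> (\<forall>b\<in>B. \<exists>c. f b = c *\<^sub>R b)
      \<and> S \<subseteq> span B"
    using S
  proof (induction "dim S" arbitrary: S rule: less_induct)
    case less
    show ?case
    proof (cases "S \<subseteq> {0}")
      case True
      then show ?thesis
        by (intro exI[of _ "{}"]) (auto simp: pairwise_def)
    next
      case False
      then obtain s where s: "s \<in> S" "s \<noteq> 0"
        by auto
      have "compact (sphere 0 1 \<inter> S)"
        using less.prems(1) by (intro compact_Int_closed closed_subspace) auto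
      moreover have "s /\<^sub>R norm s \<in> sphere 0 1 \<inter> S"
        using s less.prems(1) by (auto intro: subspace_scale)
      then have "sphere 0 1 \<inter> S \<noteq> {}"
        by blast
      moreover have "continuous_on (sphere 0 1 \<inter> S) (\<lambda>x. x \<bullet> f x)"
        using f by (intro continuous_intros linear_continuous_on linear_conv_bounded_linear[THEN iffD1])
      ultimately obtain v where v: "v \<in> S" "norm v = 1"
        and max: "\<And>x. \<lbrakk>x \<in> S; norm x = 1\<rbrakk> \<Longrightarrow> x \<bullet> f x \<le> v \<bullet> f v"
        using continuous_attains_sup[of "sphere 0 1 \<inter> S" "\<lambda>x. x \<bullet> f x"]
        by (metis Int_iff mem_sphere_0)
      have eig: "f v = (v \<bullet> f v) *\<^sub>R v"
        using selfadjoint_sphere_max_eigenvector[OF f adj less.prems v max] by blast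
      define S' where "S' = S \<inter> {x. v \<bullet> x = 0}"
      have sub: "subspace S'"
        unfolding S'_def using less.prems(1) by (intro subspace_inter subspace_hyperplane)
      have "v \<bullet> f x = 0" if "v \<bullet> x = 0" for x
        using adj[of v x] eig that by (metis inner_scaleR_left mult_zero_right)
      then have inv: "f ` S' \<subseteq> S'"
        using less.prems(2) by (auto simp: S'_def)
      have "v \<notin> S'"
        using v(2) by (auto simp: S'_def)
      then have "span S' \<subset> span S"
        using sub less.prems(1) v(1) by (metis S'_def Int_lower1 psubsetI span_eq_iff)
      then have "dim S' < dim S"
        by (rule dim_psubset)
      from less.hyps[OF this sub inv] obtain B where B: "B \<subseteq> S'" "pairwise orthogonal B"
        "\<forall>b\<in>B. norm b = 1" "\<forall>b\<in>B. \<exists>c. f b = c *\<^sub>R b" "S' \<subseteq> span B"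
        by blast
      show ?thesis
      proof (intro exI[of _ "insert v B"] conjI)
        show "insert v B \<subseteq> S" "\<forall>b\<in>insert v B. norm b = 1"
          using B v by (auto simp: S'_def)
        show "\<forall>b\<in>insert v B. \<exists>c. f b = c *\<^sub>R b"
          using B eig by blast
        show "pairwise orthogonal (insert v B)"
          using B by (auto simp: pairwise_insert S'_def orthogonal_def inner_commute)
        show "S \<subseteq> span (insert v B)"
        proof
          fix x assume x: "x \<in> S"
          have "x - (v \<bullet> x) *\<^sub>R v \<in> S'"
            using x v less.prems(1)
            by (auto simp: S'_def inner_diff_right dot_square_norm intro: subspace_diff subspace_scale)
          then have "x - (v \<bullet> x) *\<^sub>R v \<in> span B"
            using B(5) by blast
          then show "x \<in> span (insert v B)"
            by (auto simp: span_insert)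
        qed
      qed
    qed
  qed
  then show thesis
    using that by blast
qed

section \<open>Orthonormal families: eigenbases, Parseval, trace\<close>

text \<open>A family rather than a set, so that eigenvalues can be listed with multiplicity along
  the index type of the matrix.\<close>

definition orthonormal_family :: "('i \<Rightarrow> 'a::real_inner) \<Rightarrow> bool" where
  "orthonormal_family u \<longleftrightarrow> (\<forall>i j. u i \<bullet> u j = (if i = j then 1 else 0))"

lemma symmetric_matrix_eigenbasis:
  fixes M :: "real^'n^'n"
  assumes "symmetric_matrix M"
  obtains u :: "'n \<Rightarrow> real^'n" and e where
    "orthonormal_family u" "\<And>i. M *v u i = e i *\<^sub>R u i"
proof -
  have adj: "(M *v x) \<bullet> y = x \<bullet> (M *v y)" for x y
    using assms by (metis dot_lmul_matrix symmetric_matrix_def transpose_matrix_vector)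
  obtain B where B: "pairwise orthogonal B" "\<And>b. b \<in> B \<Longrightarrow> norm b = 1"
    "\<And>b. b \<in> B \<Longrightarrow> \<exists>c. M *v b = c *\<^sub>R b" "UNIV \<subseteq> span B"
    using selfadjoint_orthonormal_eigenbasis[of "(*v) M" UNIV] adj
    by (metis matrix_vector_mul_linear subset_UNIV subspace_UNIV)
  have "0 \<notin> B"
    using B(2) by force
  then have "independent B"
    using B(1) by (rule pairwise_orthogonal_independent[rotated])
  then have "finite B" "card B = CARD('n)"
    using B(4) basis_card_eq_dim[of B UNIV] by (auto simp: independent_imp_finite)
  then obtain u :: "'n \<Rightarrow> real^'n" where u: "bij_betw u UNIV B"
    using finite_same_card_bij[of "UNIV :: 'n set" B] by auto
  then have uB: "u i \<in> B" for i
    by (auto simp: bij_betw_def)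
  have "orthonormal_family u"
    unfolding orthonormal_family_def
  proof (intro allI)
    fix i j
    have "u i \<noteq> u j" if "i \<noteq> j"
      using u that by (auto simp: bij_betw_def inj_def)
    then show "u i \<bullet> u j = (if i = j then 1 else 0)"
      using B(1) B(2)[OF uB] uB by (simp add: dot_square_norm pairwise_def orthogonal_def)
  qed
  moreover obtain e where "\<And>i. M *v u i = e i *\<^sub>R u i"
    using B(3)[OF uB] by metis
  ultimately show thesis
    by (rule that)
qed

definition column_matrix :: "('n \<Rightarrow> 'a^'m) \<Rightarrow> 'a^'n^'m" where
  "column_matrix u = (\<chi> a i. u i $ a)"

lemma orthogonal_column_matrix:
  fixes u :: "'n \<Rightarrow> real^'n"
  assumes "orthonormal_family u"
  shows "transpose (column_matrix u) ** column_matrix u = mat 1"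
    and "column_matrix u ** transpose (column_matrix u) = mat 1"
proof -
  show *: "transpose (column_matrix u) ** column_matrix u = mat 1"
    using assms by (simp add: vec_eq_iff matrix_matrix_mult_def transpose_def column_matrix_def mat_def
        orthonormal_family_def inner_vec_def)
  show "column_matrix u ** transpose (column_matrix u) = mat 1"
    using * by (simp only: matrix_left_right_inverse)
qed

text \<open>The numbers \<open>u i \<bullet> z\<close> are the entries of P^T z, where P has the
  columns \<open>u i\<close>, and P P^T is the identity.\<close>

lemma orthonormal_family_Parseval:
  fixes u :: "'n \<Rightarrow> real^'n"
  assumes "orthonormal_family u"
  shows "(\<Sum>i\<in>UNIV. (u i \<bullet> x) * (u i \<bullet> y)) = x \<bullet> y"
proof -
  let ?P = "column_matrix u"
  have comp: "(transpose ?P *v z) $ i = u i \<bullet> z" for z i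
    by (simp add: matrix_vector_mult_def transpose_def column_matrix_def inner_vec_def del: transpose_matrix_vector)
  have "(\<Sum>i\<in>UNIV. (u i \<bullet> x) * (u i \<bullet> y)) = (transpose ?P *v x) \<bullet> (transpose ?P *v y)"
    unfolding inner_vec_def comp by simp
  also have "\<dots> = x \<bullet> ((?P ** transpose ?P) *v y)"
    by (simp add: dot_lmul_matrix matrix_vector_mul_assoc[symmetric])
  also have "\<dots> = x \<bullet> y"
    by (simp add: orthogonal_column_matrix[OF assms])
  finally show ?thesis .
qed

text \<open>Insert P P^T = 1 and use cyclicity: the sum runs over the diagonal of P^T M P.\<close>

lemma orthonormal_family_trace:
  fixes u :: "'n \<Rightarrow> real^'n"
  assumes "orthonormal_family u"
  shows "trace M = (\<Sum>i\<in>UNIV. u i \<bullet> (M *v u i))"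
proof -
  let ?P = "column_matrix u"
  have "trace M = trace (M ** ?P ** transpose ?P)"
    by (simp add: matrix_mul_assoc[symmetric] orthogonal_column_matrix[OF assms])
  also have "\<dots> = trace (transpose ?P ** (M ** ?P))"
    by (rule trace_mul_sym)
  also have "\<dots> = (\<Sum>i\<in>UNIV. u i \<bullet> (M *v u i))"
    by (simp add: trace_def matrix_matrix_mult_def matrix_vector_mult_def transpose_def
        column_matrix_def inner_vec_def)
  finally show ?thesis .
qed

section \<open>Characteristic polynomial and singular values from an eigenbasis\<close>

lemma const_poly_sum: "[:sum f A:] = (\<Sum>x\<in>A. [:f x:])"
  by (intro poly_eqI) (simp add: coeff_sum coeff_pCons split: nat.split)

text \<open>Diagonalisation is carried out over the polynomial ring, with the eigenvectors as
  constant polynomials. Since \<open>det C\<close> is nonzero and real polynomials form an integral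
  domain, it cancels from the determinants.\<close>

lemma charpoly_eigenbasis:
  fixes M :: "real^'n^'n" and u :: "'n \<Rightarrow> real^'n"
  assumes u: "orthonormal_family u" and e: "\<And>i. M *v u i = e i *\<^sub>R u i"
  shows "charpoly M = (\<Prod>i\<in>UNIV. [:- e i, 1:])"
proof -
  define C :: "real poly^'n^'n" where "C = (\<chi> a i. [:u i $ a:])"
  define X :: "real poly^'n^'n" where
    "X = (\<chi> i j. (if i = j then [:0, 1:] else 0) - [:M $ i $ j:])"
  define D :: "real poly^'n^'n" where "D = (\<chi> i j. if i = j then [:- e i, 1:] else 0)"
  have ev: "(\<Sum>b\<in>UNIV. M $ a $ b * u i $ b) = e i * u i $ a" for a i
    using e[of i] by (simp add: vec_eq_iff matrix_vector_mult_def)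
  have "transpose C ** C = mat 1"
    using u by (simp add: vec_eq_iff matrix_matrix_mult_def transpose_def C_def mat_def
        orthonormal_family_def inner_vec_def const_poly_sum[symmetric] one_pCons)
  then have "det C * det C = 1"
    by (metis det_I det_mul det_transpose)
  then have C: "det C \<noteq> 0"
    by auto
  \<comment> \<open>Over the polynomial ring, \<open>(x I - M) C = C (x I - diag e)\<close>.\<close>
  have "(X ** C) $ a $ i = (C ** D) $ a $ i" for a i
  proof -
    have "(X ** C) $ a $ i = (\<Sum>b\<in>UNIV. (if a = b then [:0, 1:] * [:u i $ b:] else 0))
        - (\<Sum>b\<in>UNIV. [:M $ a $ b * u i $ b:])"
      unfolding sum_subtractf[symmetric]
      by (auto simp: matrix_matrix_mult_def X_def C_def left_diff_distrib intro!: sum.cong)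
    also have "\<dots> = [:0, 1:] * [:u i $ a:] - [:e i * u i $ a:]"
      by (simp add: const_poly_sum[symmetric] ev)
    also have "\<dots> = (\<Sum>j\<in>UNIV. if j = i then [:u i $ a:] * [:- e i, 1:] else 0)"
      by simp
    also have "\<dots> = (C ** D) $ a $ i"
      unfolding matrix_matrix_mult_def D_def C_def vec_lambda_beta by (intro sum.cong) auto
    finally show ?thesis .
  qed
  then have "det X * det C = det C * det D"
    by (metis vec_eq_iff det_mul)
  then have "det X = det D"
    using C by simp
  also have "\<dots> = (\<Prod>i\<in>UNIV. [:- e i, 1:])"
    unfolding D_def by (subst det_diagonal) auto
  finally show ?thesis
    by (simp add: charpoly_def X_def)
qed

lemma singular_values_eigenbasis:
  fixes Z :: "real^'n^'m" and u :: "'n \<Rightarrow> real^'n"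
  assumes "orthonormal_family u" "\<And>i. (transpose Z ** Z) *v u i = e i *\<^sub>R u i"
  shows "singular_values Z = image_mset (\<lambda>i. sqrt (e i)) (mset_set UNIV)"
proof -
  have "proots (\<Prod>i\<in>(UNIV::'n set). [:- e i, 1:]) = (\<Sum>i\<in>(UNIV::'n set). {#e i#})"
    by (subst proots_prod) auto
  also have "\<dots> = image_mset e (mset_set UNIV)"
    by (simp add: sum_unfold_sum_mset image_mset.compositionality[symmetric] comp_def)
  finally show ?thesis
    by (simp add: singular_values_def charpoly_eigenbasis[OF assms] image_mset.compositionality comp_def)
qed

section \<open>Bessel's inequality and weighted Hoelder\<close>

text \<open>With \<open>s\<close> as below, \<open>s \<bullet> s \<le> s \<bullet> v\<close>, and
  expanding the square of \<open>v - s\<close> gives the bound. Norms at most 1 are allowed so that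
  normalised families may contain zero vectors.\<close>

lemma Bessel_inequality_finite:
  fixes w :: "'i \<Rightarrow> 'a::real_inner"
  assumes "finite I" and orth: "\<And>i j. \<lbrakk>i \<in> I; j \<in> I; i \<noteq> j\<rbrakk> \<Longrightarrow> w i \<bullet> w j = 0"
    and le: "\<And>i. i \<in> I \<Longrightarrow> norm (w i) \<le> 1"
  shows "(\<Sum>i\<in>I. (w i \<bullet> v)\<^sup>2) \<le> (norm v)\<^sup>2"
proof -
  define s where "s = (\<Sum>i\<in>I. (w i \<bullet> v) *\<^sub>R w i)"
  have sv: "s \<bullet> v = (\<Sum>i\<in>I. (w i \<bullet> v)\<^sup>2)"
    by (simp add: s_def inner_sum_left power2_eq_square)
  have "s \<bullet> s = (\<Sum>i\<in>I. \<Sum>j\<in>I. if j = i then (w i \<bullet> v)\<^sup>2 * (norm (w i))\<^sup>2 else 0)"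
    unfolding s_def inner_sum_left inner_sum_right
    by (intro sum.cong refl) (auto simp: orth dot_square_norm power2_eq_square)
  also have "\<dots> = (\<Sum>i\<in>I. (w i \<bullet> v)\<^sup>2 * (norm (w i))\<^sup>2)"
    using assms(1) by simp
  also have "\<dots> \<le> (\<Sum>i\<in>I. (w i \<bullet> v)\<^sup>2)"
    using le by (intro sum_mono mult_left_le) (auto simp: power_le_one)
  finally have "s \<bullet> s \<le> s \<bullet> v"
    by (simp add: sv)
  moreover have "0 \<le> (v - s) \<bullet> (v - s)"
    by simp
  ultimately show ?thesis
    unfolding sv[symmetric] by (simp add: inner_diff_left inner_diff_right inner_commute power2_norm_eq_inner)
qed

text \<open>Divide by the totals \<open>X\<close> and \<open>Y\<close>, apply Young's inequality to
  each term and sum with weights \<open>d i\<close>; the right side collapses because t + (1 - t) =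
  1.\<close>

lemma weighted_Holder_sum:
  fixes d x y :: "'i \<Rightarrow> real"
  assumes "finite I" "0 < t" "t < 1"
    and nn: "\<And>i. i \<in> I \<Longrightarrow> d i \<ge> 0" "\<And>i. i \<in> I \<Longrightarrow> x i \<ge> 0" "\<And>i. i \<in> I \<Longrightarrow> y i \<ge> 0"
  shows "(\<Sum>i\<in>I. d i * (x i powr t * y i powr (1 - t)))
    \<le> (\<Sum>i\<in>I. d i * x i) powr t * (\<Sum>i\<in>I. d i * y i) powr (1 - t)"
proof -
  define X where "X = (\<Sum>i\<in>I. d i * x i)"
  define Y where "Y = (\<Sum>i\<in>I. d i * y i)"
  have XY: "X \<ge> 0" "Y \<ge> 0"
    using nn by (auto simp: X_def Y_def intro!: sum_nonneg)
  show ?thesis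
  proof (cases "X = 0 \<or> Y = 0")
    case True
    \<comment> \<open>A vanishing total of nonnegative terms forces every term to vanish, and
      \<open>0 powr a = 0\<close>.\<close>
    then have zero: "d i * (x i powr t * y i powr (1 - t)) = 0" if "i \<in> I" for i
      using that nn sum_nonneg_eq_0_iff[OF assms(1), of "\<lambda>i. d i * x i"]
        sum_nonneg_eq_0_iff[OF assms(1), of "\<lambda>i. d i * y i"]
      unfolding X_def Y_def by auto
    then show ?thesis
      by (simp only: sum.neutral[OF ballI, OF zero]) simp
  next
    case False
    with XY have pos: "X > 0" "Y > 0"
      by auto
    have young: "x i powr t * y i powr (1 - t) \<le> X powr t * Y powr (1 - t) * (t * (x i / X) + (1 - t) * (y i / Y))"
      if i: "i \<in> I" for i
    proof (cases "x i = 0 \<or> y i = 0")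
      case True
      then show ?thesis
        using assms(2,3) pos nn(2,3)[OF i] by auto
    next
      case False
      with nn(2,3)[OF i] have "x i > 0" "y i > 0"
        by auto
      then have "(x i / X) powr t * (y i / Y) powr (1 - t) \<le> t * (x i / X) + (1 - t) * (y i / Y)"
        using assms(2,3) pos by (intro Youngs_inequality_0) auto
      then show ?thesis
        using pos \<open>x i > 0\<close> \<open>y i > 0\<close> by (simp add: powr_divide field_simps)
    qed
    have "(\<Sum>i\<in>I. d i * (x i powr t * y i powr (1 - t)))
        \<le> (\<Sum>i\<in>I. d i * (X powr t * Y powr (1 - t) * (t * (x i / X) + (1 - t) * (y i / Y))))"
      using nn(1) young by (intro sum_mono mult_left_mono)
    also have "\<dots> = (\<Sum>i\<in>I. X powr t * Y powr (1 - t) * (t / X) * (d i * x i)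
        + X powr t * Y powr (1 - t) * ((1 - t) / Y) * (d i * y i))"
      by (intro sum.cong refl) (simp add: algebra_simps)
    also have "\<dots> = X powr t * Y powr (1 - t) * (t / X) * X + X powr t * Y powr (1 - t) * ((1 - t) / Y) * Y"
      by (simp only: sum.distrib sum_distrib_left[symmetric] X_def[symmetric] Y_def[symmetric])
    also have "\<dots> = X powr t * Y powr (1 - t)"
      using pos by (simp add: field_simps)
    finally show ?thesis
      by (simp add: X_def Y_def)
  qed
qed


section \<open>Schatten norms and inverses via eigenbases\<close>

lemma inner_matrix_transpose:
  fixes A :: "real^'n^'m"
  shows "(A *v x) \<bullet> y = x \<bullet> (transpose A *v y)"
  by (metis dot_lmul_matrix inner_commute transpose_matrix_vector)

text \<open>Writing the eigenvalues as squares of nonnegative \<open>s i\<close> undoes the square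
  root in the definition of singular values.\<close>

lemma schatten_norm_eigenbasis:
  fixes Z :: "real^'n^'m" and u :: "'n \<Rightarrow> real^'n"
  assumes "orthonormal_family u" "\<And>i. (transpose Z ** Z) *v u i = (s i)\<^sup>2 *\<^sub>R u i" "\<And>i. s i \<ge> 0"
  shows "schatten_norm (ereal r) Z = (\<Sum>i\<in>UNIV. s i powr r) powr (1 / r)"
    and "schatten_norm \<infinity> Z = Max (range s)"
  using assms(3)
  by (simp_all add: schatten_norm_def singular_values_eigenbasis[OF assms(1,2)]
      image_mset.compositionality comp_def sum_unfold_sum_mset)

text \<open>Positive definiteness makes the kernel trivial, which gives a left inverse; for a square
  matrix it is two-sided, as the choice in \<open>matrix_inv\<close> requires.\<close>

lemma positive_definite_matrix_inv:
  assumes "positive_definite M"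
  shows "matrix_inv M ** M = mat 1"
proof -
  have "\<exists>B. B ** M = mat 1"
    using assms unfolding matrix_left_invertible_ker positive_definite_def
    by (metis inner_zero_right less_irrefl)
  then have "\<exists>B. M ** B = mat 1 \<and> B ** M = mat 1"
    by (metis matrix_left_right_inverse)
  then show ?thesis
    unfolding matrix_inv_def by (rule someI2_ex) blast
qed

section \<open>Comparison of the Schatten norm with the trace\<close>

theorem lemma3:
  fixes A :: "real^'n^'m"
    and \<Lambda> :: "real^'m^'m"
    and q :: real
  assumes "1 \<le> q" and "q \<le> 2"
    and "symmetric_matrix \<Lambda>" and "positive_definite \<Lambda>"
  shows "(schatten_norm (ereal q) A)\<^sup>2
    \<le> schatten_norm (if q = 2 then \<infinity> else ereal (q / (2 - q))) \<Lambda>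
        * trace (A ** transpose A ** matrix_inv \<Lambda>)"
proof -
  have "symmetric_matrix (transpose A ** A)"
    by (simp add: symmetric_matrix_def matrix_transpose_mul)
  then obtain u :: "'n \<Rightarrow> real^'n" and e where u: "orthonormal_family u"
    and e: "\<And>i. (transpose A ** A) *v u i = e i *\<^sub>R u i"
    by (rule symmetric_matrix_eigenbasis) blast
  obtain v :: "'m \<Rightarrow> real^'m" and \<mu> where v: "orthonormal_family v"
    and \<mu>: "\<And>j. \<Lambda> *v v j = \<mu> j *\<^sub>R v j"
    using assms(3) by (rule symmetric_matrix_eigenbasis) blast
  define s where "s i = norm (A *v u i)" for i
  \<comment> \<open>If \<open>s i = 0\<close> then \<open>d i j = 0\<close>, as \<open>inverse 0 = 0\<close>.\<close>
  define d where "d i j = (((A *v u i) /\<^sub>R s i) \<bullet> v j)\<^sup>2" for i j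
  \<comment> \<open>The images of the eigenvectors are pairwise orthogonal, as Bessel's inequality
    demands in \<open>d_col\<close>.\<close>
  have Au: "(A *v u i) \<bullet> (A *v u j) = (if i = j then e j else 0)" for i j
  proof -
    have "(A *v u i) \<bullet> (A *v u j) = u i \<bullet> ((transpose A ** A) *v u j)"
      by (simp only: inner_matrix_transpose matrix_vector_mul_assoc)
    then show ?thesis
      using u by (simp add: e orthonormal_family_def)
  qed
  have e_eq: "e i = (s i)\<^sup>2" for i
    using Au[of i i] by (simp add: s_def power2_norm_eq_inner)
  have s_nn: "s i \<ge> 0" for i
    by (simp add: s_def)
  have d_nn: "d i j \<ge> 0" for i j
    by (simp add: d_def)
  have d_row: "(\<Sum>j\<in>UNIV. d i j) = 1" if "s i \<noteq> 0" for i
    using orthonormal_family_Parseval[OF v, of "(A *v u i) /\<^sub>R s i" "(A *v u i) /\<^sub>R s i"] that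
    by (simp add: d_def power2_eq_square inner_commute s_def flip: power2_norm_eq_inner)
  have d_col: "(\<Sum>i\<in>UNIV. d i j) \<le> 1" for j
  proof -
    have "(\<Sum>i\<in>UNIV. d i j) \<le> (norm (v j))\<^sup>2"
      unfolding d_def by (rule Bessel_inequality_finite) (auto simp: Au s_def field_simps)
    then show ?thesis
      using v by (simp add: orthonormal_family_def power2_norm_eq_inner)
  qed
  have \<mu>_pos: "\<mu> j > 0" for j
  proof -
    have "v j \<bullet> v j = 1"
      using v by (simp add: orthonormal_family_def)
    then show ?thesis
      using assms(4) \<mu>[of j] unfolding positive_definite_def
      by (metis inner_scaleR_right inner_zero_left mult.right_neutral zero_neq_one)
  qed
  \<comment> \<open>By symmetry and positivity the \<open>\<mu> j\<close> are also the singular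
    values of \<open>\<Lambda>\<close>.\<close>
  have \<Lambda>_sq: "(transpose \<Lambda> ** \<Lambda>) *v v j = (\<mu> j)\<^sup>2 *\<^sub>R v j" for j
  proof -
    have "(transpose \<Lambda> ** \<Lambda>) *v v j = \<Lambda> *v (\<Lambda> *v v j)"
      using assms(3) by (simp only: symmetric_matrix_def matrix_vector_mul_assoc)
    then show ?thesis
      by (simp add: \<mu> matrix_vector_mult_scaleR power2_eq_square)
  qed
  have inv_v: "matrix_inv \<Lambda> *v v j = v j /\<^sub>R \<mu> j" for j
  proof -
    have "\<mu> j *\<^sub>R (matrix_inv \<Lambda> *v v j) = (matrix_inv \<Lambda> ** \<Lambda>) *v v j"
      by (simp add: matrix_vector_mul_assoc[symmetric] \<mu> matrix_vector_mult_scaleR)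
    then have "\<mu> j *\<^sub>R (matrix_inv \<Lambda> *v v j) = v j"
      by (simp add: positive_definite_matrix_inv[OF assms(4)])
    then show ?thesis
      using \<mu>_pos[of j] by (metis scaleR_scaleR left_inverse less_irrefl scaleR_one)
  qed
  define T where "T = trace (A ** transpose A ** matrix_inv \<Lambda>)"
  \<comment> \<open>The trace is evaluated in the basis \<open>v\<close>, then the squared norm of
    A^T v_j is expanded in the basis \<open>u\<close>.\<close>
  have T_eq: "T = (\<Sum>(i, j)\<in>UNIV. d i j * ((s i)\<^sup>2 / \<mu> j))"
  proof -
    have "v j \<bullet> ((A ** transpose A ** matrix_inv \<Lambda>) *v v j) = (\<Sum>i\<in>UNIV. d i j * ((s i)\<^sup>2 / \<mu> j))" for j
    proof -
      have "v j \<bullet> ((A ** transpose A ** matrix_inv \<Lambda>) *v v j)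
          = v j \<bullet> (A *v (transpose A *v v j)) / \<mu> j"
        by (simp only: matrix_vector_mul_assoc[symmetric] inv_v matrix_vector_mult_scaleR
            inner_scaleR_right) (simp add: divide_inverse)
      also have "v j \<bullet> (A *v (transpose A *v v j)) = (transpose A *v v j) \<bullet> (transpose A *v v j)"
        by (metis inner_matrix_transpose inner_commute)
      also have "\<dots> = (\<Sum>i\<in>UNIV. ((A *v u i) \<bullet> v j)\<^sup>2)"
        by (subst orthonormal_family_Parseval[OF u, symmetric])
          (simp only: inner_matrix_transpose power2_eq_square)
      also have "\<dots> = (\<Sum>i\<in>UNIV. d i j * (s i)\<^sup>2)"
        by (intro sum.cong refl) (auto simp: d_def s_def power_mult_distrib field_simps)
      finally show ?thesis
        by (simp add: sum_divide_distrib)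
    qed
    then have "T = (\<Sum>j\<in>UNIV. \<Sum>i\<in>UNIV. d i j * ((s i)\<^sup>2 / \<mu> j))"
      by (simp add: T_def orthonormal_family_trace[OF v])
    also have "\<dots> = (\<Sum>i\<in>UNIV. \<Sum>j\<in>UNIV. d i j * ((s i)\<^sup>2 / \<mu> j))"
      by (rule sum.swap)
    finally show ?thesis
      by (simp add: sum.cartesian_product)
  qed
  have term_nn: "d i j * ((s i)\<^sup>2 / \<mu> j) \<ge> 0" for i j
    using d_nn \<mu>_pos[of j] by (simp add: less_imp_le)
  then have T_nn: "T \<ge> 0"
    unfolding T_eq by (intro sum_nonneg) auto
  have A_norm: "schatten_norm (ereal q) A = (\<Sum>i\<in>UNIV. s i powr q) powr (1 / q)"
    by (rule schatten_norm_eigenbasis(1)[OF u e[unfolded e_eq] s_nn])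
  show ?thesis
  proof (cases "q = 2")
    case True
    have \<Lambda>_norm: "schatten_norm \<infinity> \<Lambda> = Max (range \<mu>)"
      using v \<Lambda>_sq \<mu>_pos by (intro schatten_norm_eigenbasis) (auto intro: less_imp_le)
    have "(schatten_norm (ereal q) A)\<^sup>2 = (\<Sum>i\<in>UNIV. (s i)\<^sup>2)"
      unfolding A_norm using True s_nn by (simp add: powr_half_sqrt sum_nonneg)
    \<comment> \<open>Row sums are 1 unless \<open>s i = 0\<close>, where both sides vanish.\<close>
    also have "\<dots> = (\<Sum>i\<in>UNIV. \<Sum>j\<in>UNIV. d i j * (s i)\<^sup>2)"
      using d_row by (intro sum.cong refl) (auto simp flip: sum_distrib_right)
    also have "\<dots> = (\<Sum>(i, j)\<in>UNIV. d i j * (s i)\<^sup>2)"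
      by (simp add: sum.cartesian_product)
    \<comment> \<open>The endpoint form of Hoelder: each \<open>\<mu> j\<close> is bounded by the
      largest one.\<close>
    also have "\<dots> \<le> (\<Sum>(i, j)\<in>UNIV. Max (range \<mu>) * (d i j * ((s i)\<^sup>2 / \<mu> j)))"
    proof (intro sum_mono, clarify)
      fix i j
      have "\<mu> j * (d i j * ((s i)\<^sup>2 / \<mu> j)) \<le> Max (range \<mu>) * (d i j * ((s i)\<^sup>2 / \<mu> j))"
        using term_nn by (intro mult_right_mono) auto
      then show "d i j * (s i)\<^sup>2 \<le> Max (range \<mu>) * (d i j * ((s i)\<^sup>2 / \<mu> j))"
        using \<mu>_pos[of j] by simp
    qed
    also have "\<dots> = Max (range \<mu>) * T"
      by (simp add: T_eq sum_distrib_left case_prod_beta)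
    finally show ?thesis
      using True by (simp add: \<Lambda>_norm T_def)
  next
    case False
    \<comment> \<open>Here 1/t = 2/q and 1/(1 - t) = 2/(2 - q) are the conjugate Hoelder exponents,
      and \<open>p\<close> is the Schatten exponent of \<open>\<Lambda>\<close>.\<close>
    define t where "t = q / 2"
    define p where "p = q / (2 - q)"
    have q: "1 \<le> q" "q < 2"
      using assms(1,2) False by auto
    have t: "0 < t" "t < 1" and p_t: "p * (1 - t) = t"
      using q by (auto simp: t_def p_def field_simps)
    define N where "N = (\<Sum>j\<in>UNIV. \<mu> j powr p)"
    have \<Lambda>_norm: "schatten_norm (ereal p) \<Lambda> = N powr (1 / p)"
      unfolding N_def
      using v \<Lambda>_sq \<mu>_pos by (intro schatten_norm_eigenbasis) (auto intro: less_imp_le)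
    have N_nn: "N \<ge> 0"
      by (simp add: N_def sum_nonneg)
    \<comment> \<open>By \<open>p_t\<close> the second factor is \<open>\<mu> j powr t\<close>,
      which cancels the denominator of the first; the row sum then removes
      \<open>d i j\<close>.\<close>
    have term_eq: "s i powr q = (\<Sum>j\<in>UNIV. d i j * (((s i)\<^sup>2 / \<mu> j) powr t * (\<mu> j powr p) powr (1 - t)))" for i
    proof (cases "s i = 0")
      case False
      then have "s i > 0"
        using s_nn[of i] by simp
      then have "(s i)\<^sup>2 powr t = s i powr q"
        by (simp add: power2_eq_square powr_mult t_def flip: powr_add)
      then have "((s i)\<^sup>2 / \<mu> j) powr t * (\<mu> j powr p) powr (1 - t) = s i powr q" for j
        using \<mu>_pos[of j]
        by (simp add: powr_divide powr_powr p_t)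
      then show ?thesis
        using d_row[OF False] by (simp flip: sum_distrib_right)
    qed simp
    have "(\<Sum>i\<in>UNIV. s i powr q)
        = (\<Sum>(i, j)\<in>UNIV. d i j * (((s i)\<^sup>2 / \<mu> j) powr t * (\<mu> j powr p) powr (1 - t)))"
      unfolding term_eq by (simp add: sum.cartesian_product)
    also have "\<dots> \<le> (\<Sum>(i, j)\<in>UNIV. d i j * ((s i)\<^sup>2 / \<mu> j)) powr t
        * (\<Sum>(i, j)\<in>UNIV. d i j * \<mu> j powr p) powr (1 - t)"
      using weighted_Holder_sum[OF _ t, of UNIV "\<lambda>(i, j). d i j" "\<lambda>(i, j). (s i)\<^sup>2 / \<mu> j"
          "\<lambda>(i, j). \<mu> j powr p"] d_nn \<mu>_pos
      by (simp add: case_prod_beta less_imp_le)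
    also have "\<dots> \<le> T powr t * N powr (1 - t)"
    proof -
      have "(\<Sum>(i, j)\<in>UNIV. d i j * \<mu> j powr p) = (\<Sum>i\<in>UNIV. \<Sum>j\<in>UNIV. d i j * \<mu> j powr p)"
        by (simp add: sum.cartesian_product)
      also have "\<dots> = (\<Sum>j\<in>UNIV. \<Sum>i\<in>UNIV. d i j * \<mu> j powr p)"
        by (rule sum.swap)
      \<comment> \<open>The column sums of \<open>d\<close> are at most 1.\<close>
      also have "\<dots> \<le> N"
        unfolding N_def sum_distrib_right[symmetric]
        using d_col d_nn by (intro sum_mono mult_left_le_one_le) (auto intro: sum_nonneg)
      finally have "(\<Sum>(i, j)\<in>UNIV. d i j * \<mu> j powr p) \<le> N" .
      then show ?thesis
        unfolding T_eq[symmetric] using t d_nn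
        by (intro mult_left_mono powr_mono2) (auto intro!: sum_nonneg)
    qed
    finally have S_le: "(\<Sum>i\<in>UNIV. s i powr q) \<le> T powr t * N powr (1 - t)" .
    have "(schatten_norm (ereal q) A)\<^sup>2 = (\<Sum>i\<in>UNIV. s i powr q) powr (2 / q)"
      by (simp add: A_norm power2_eq_square flip: powr_add)
    \<comment> \<open>The power 2/q is chosen so that \<open>T\<close> ends up with exponent 1 and
      \<open>N\<close> with exponent 1/p, giving the norm of \<open>\<Lambda>\<close>.\<close>
    also have "\<dots> \<le> (T powr t * N powr (1 - t)) powr (2 / q)"
      using S_le q by (intro powr_mono2) (auto intro: sum_nonneg)
    also have "\<dots> = T powr (t * (2 / q)) * N powr ((1 - t) * (2 / q))"
      by (simp add: powr_mult powr_powr)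
    also have "t * (2 / q) = 1"
      using q by (simp add: t_def)
    also have "(1 - t) * (2 / q) = 1 / p"
      using q by (simp add: t_def p_def field_simps)
    finally show ?thesis
      using False T_nn by (simp add: \<Lambda>_norm T_def p_def[symmetric] mult.commute)
  qed
qed

end
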